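(* Let $k\geq 1$ and $0\leq \alpha\leq k$ be integers. If $A$ is a set of $k$ positive integers, then \[|\Sigma_{\alpha}(A)|\geq \frac{k(k+1)}{2}-\frac{\alpha(\alpha+1)}{2}+1.\] Moreover, this lower bound is best possible, i.e., it is attained by some set of $k$ positive integers.
   Context: For a finite set $A$ of integers with $|A|=k$ and an integer $0\leq\alpha\leq k$, $\Sigma_{\alpha}(A)=\{s(B): B\subseteq A,\ |B|\geq \alpha\}$, where $s(B)=\sum_{b\in B} b$ and $s(\emptyset)=0$. *)

theory Defs
  imports Complex_Main
begin

definition subset_sums :: "nat \<Rightarrow> int set \<Rightarrow> int set" where
  "subset_sums \<alpha> A = {(\<Sum>b\<in>B. b) | B. B \<subseteq> A \<and> card B \<ge> \<alpha>}"

end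

theory Submission
  imports Defs
begin

text \<open>
  Lower bound: remove the largest element \<open>m\<close> of \<open>A\<close> and write \<open>A'\<close> for the rest. If
  \<open>\<alpha> < k\<close>, then \<open>s(A)\<close> and the \<open>k - 1\<close> numbers \<open>s(A) - a\<close> with \<open>a \<in> A'\<close> are \<open>k\<close> distinct
  elements of \<open>\<Sigma>\<^sub>\<alpha>(A)\<close>, all exceeding \<open>s(A') = max \<Sigma>\<^sub>\<alpha>(A')\<close>, so each step up to size \<open>k\<close> adds at
  least \<open>k\<close> sums. Sharpness: for \<open>A = {1, \<dots>, k}\<close> all sums lie between \<open>\<alpha>(\<alpha>+1)/2\<close>
  and \<open>k(k+1)/2\<close>.
\<close>

lemma finite_subset_sums: "finite A \<Longrightarrow> finite (subset_sums \<alpha> A)"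
  by (rule finite_subset[of _ "sum (\<lambda>b. b) ` Pow A"]) (auto simp: subset_sums_def)

lemma subset_sumsI: "B \<subseteq> A \<Longrightarrow> \<alpha> \<le> card B \<Longrightarrow> \<Sum>B \<in> subset_sums \<alpha> A"
  by (auto simp: subset_sums_def)

lemma subset_sums_le_sum:
  assumes "finite A" "\<forall>a\<in>A. a > 0" "x \<in> subset_sums \<alpha> A"
  shows "x \<le> \<Sum>A"
proof -
  obtain B where "B \<subseteq> A" "x = \<Sum>B"
    using assms(3) by (auto simp: subset_sums_def)
  then show ?thesis
    using assms(1,2) by (auto intro!: sum_mono2 dest: less_imp_le)
qed

lemma card_subset_sums_insert_max:
  assumes fin: "finite A" and pos: "\<forall>a\<in>A. a > 0" and m: "\<forall>a\<in>A. a < m" "m > 0"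
    and \<alpha>: "\<alpha> \<le> card A"
  shows "card (subset_sums \<alpha> A) + Suc (card A) \<le> card (subset_sums \<alpha> (insert m A))"
proof -
  have mA: "m \<notin> A" using m(1) by blast
  define S where "S = \<Sum>(insert m A)"
  define N where "N = insert S ((\<lambda>a. S - a) ` A)"
  have S: "S = m + \<Sum>A" unfolding S_def using fin mA by simp
  have "S \<notin> (\<lambda>a. S - a) ` A" using pos by auto
  then have card_N: "card N = Suc (card A)"
    using fin by (simp add: N_def card_image inj_on_def)
  \<comment> \<open>Here \<open>S - a\<close> equals \<open>\<Sum>A + (m - a)\<close>, and
    \<open>m - a\<close> is positive because \<open>m\<close> is the strict maximum.\<close>
  have N_big: "x > \<Sum>A" if "x \<in> N" for x
    using that m S by (auto simp: N_def)
  have "N \<subseteq> subset_sums \<alpha> (insert m A)"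
  proof
    fix x assume "x \<in> N"
    then consider "x = S" | a where "a \<in> A" "x = S - a" by (auto simp: N_def)
    then show "x \<in> subset_sums \<alpha> (insert m A)"
    proof cases
      case 1
      then show ?thesis
        using subset_sumsI[of "insert m A" "insert m A" \<alpha>] fin mA \<alpha> by (simp add: S_def)
    next
      case 2
      have "x = \<Sum>(insert m A - {a})"
        using 2 fin by (simp add: S_def sum_diff1)
      \<comment> \<open>Dropping one element from the enlarged set still leaves
        \<open>card A\<close> elements, so \<open>\<alpha> \<le> card A\<close> makes these sums
        admissible.\<close>
      moreover have "card (insert m A - {a}) = card A"
        using 2 fin mA by (simp add: card_Diff_singleton)
      ultimately show ?thesis
        using \<alpha> by (auto intro!: subset_sumsI)
    qed
  qed
  moreover have "subset_sums \<alpha> A \<subseteq> subset_sums \<alpha> (insert m A)"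
    unfolding subset_sums_def by blast
  ultimately have "card (subset_sums \<alpha> A \<union> N) \<le> card (subset_sums \<alpha> (insert m A))"
    using fin by (intro card_mono finite_subset_sums) auto
  moreover have "subset_sums \<alpha> A \<inter> N = {}"
    using subset_sums_le_sum[OF fin pos] N_big by fastforce
  moreover have "finite N" using fin by (simp add: N_def)
  ultimately show ?thesis
    using fin card_N by (simp add: card_Un_disjoint finite_subset_sums)
qed

text \<open>Doubling the bound and moving the negative term to the other side avoids division and
  truncated subtraction on \<open>nat\<close>. Elements are added in increasing order; the count
  starts to matter once the size reaches \<open>\<alpha>\<close>.\<close>

lemma card_subset_sums_ge:
  assumes "finite A" "\<forall>a\<in>A. a > 0" "\<alpha> \<le> card A"
  shows "card A * (card A + 1) + 2 \<le> 2 * card (subset_sums \<alpha> A) + \<alpha> * (\<alpha> + 1)"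
  using assms
proof (induction A rule: finite_linorder_max_induct)
  case empty
  have "subset_sums 0 {} = {0}" by (auto simp: subset_sums_def)
  then show ?case using empty by simp
next
  case (insert m A)
  then have mA: "m \<notin> A" by blast
  show ?case
  proof (cases "\<alpha> \<le> card A")
    case True
    \<comment> \<open>The gain of \<open>Suc (card A)\<close> sums, doubled, is exactly (n+1)(n+2) -
      n(n+1) for n = \<open>card A\<close>.\<close>
    then show ?thesis
      using insert mA card_subset_sums_insert_max[of A m \<alpha>] by simp
  next
    case False
    \<comment> \<open>When \<open>\<alpha>\<close> is the full size, the quadratic terms cancel and
      a single admissible sum suffices.\<close>
    then have \<alpha>: "\<alpha> = card (insert m A)"
      using insert mA by simp
    then have "\<Sum>(insert m A) \<in> subset_sums \<alpha> (insert m A)"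
      by (intro subset_sumsI) auto
    then have "0 < card (subset_sums \<alpha> (insert m A))"
      using finite_subset_sums[of "insert m A"] insert.hyps(1) by (auto simp: card_gt_0_iff)
    then show ?thesis using \<alpha> by simp
  qed
qed

text \<open>By induction on the maximum: the largest of n distinct positive integers is at least n,
  so the sum is at least 1 + ... + n.\<close>

lemma sum_pos_ints_ge:
  fixes B :: "int set"
  assumes "finite B" "\<forall>b\<in>B. b > 0"
  shows "int (card B * (card B + 1)) \<le> 2 * \<Sum>B"
  using assms
proof (induction B rule: finite_linorder_max_induct)
  case empty
  then show ?case by simp
next
  case (insert m B)
  then have mB: "m \<notin> B" by blast
  have "insert m B \<subseteq> {1..m}"
    using insert by force
  then have "card (insert m B) \<le> card {1..m}"
    by (intro card_mono) auto
  then have "int (card B) + 1 \<le> m"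
    using insert mB by simp
  then show ?case
    using insert mB by (simp add: algebra_simps)
qed

lemma sum_atLeastAtMost_int: "2 * \<Sum>{1..int k} = int (k * (k + 1))"
proof (induction k)
  case (Suc k)
  have "{1..int (Suc k)} = insert (int (Suc k)) {1..int k}" by auto
  then show ?case using Suc by (simp add: algebra_simps)
qed simp

text \<open>The sums are confined to an interval of integers whose length equals the general lower
  bound, so both bounds meet.\<close>

lemma card_subset_sums_atLeastAtMost:
  assumes "\<alpha> \<le> k"
  shows "2 * card (subset_sums \<alpha> {1..int k}) + \<alpha> * (\<alpha> + 1) = k * (k + 1) + 2"
proof -
  define U L where "U = \<Sum>{1..int k}" and "L = \<Sum>{1..int \<alpha>}"
  have U: "2 * U = int (k * (k + 1))" and L: "2 * L = int (\<alpha> * (\<alpha> + 1))"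
    by (simp_all only: U_def L_def sum_atLeastAtMost_int)
  \<comment> \<open>This makes \<open>card {L..U}\<close> equal to \<open>U - L + 1\<close>, with no
    truncation at zero.\<close>
  have "L \<le> U"
    unfolding U_def L_def using assms by (intro sum_mono2) auto
  have "subset_sums \<alpha> {1..int k} \<subseteq> {L..U}"
  proof
    fix x assume x: "x \<in> subset_sums \<alpha> {1..int k}"
    then obtain B where B: "B \<subseteq> {1..int k}" "\<alpha> \<le> card B" "x = \<Sum>B"
      by (auto simp: subset_sums_def)
    \<comment> \<open>A subset with more than \<open>\<alpha>\<close> elements only raises the
      minimal possible sum.\<close>
    have "\<alpha> * (\<alpha> + 1) \<le> card B * (card B + 1)"
      using B by (intro mult_mono) auto
    then have "int (\<alpha> * (\<alpha> + 1)) \<le> int (card B * (card B + 1))"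
      by (simp only: of_nat_le_iff)
    also have "\<dots> \<le> 2 * \<Sum>B"
      using B(1) by (intro sum_pos_ints_ge) (auto intro: finite_subset)
    finally have "L \<le> x" using L B by linarith
    moreover have "x \<le> U"
      unfolding U_def using x by (intro subset_sums_le_sum) auto
    ultimately show "x \<in> {L..U}" by simp
  qed
  then have "card (subset_sums \<alpha> {1..int k}) \<le> card {L..U}"
    by (intro card_mono) auto
  then have "int (card (subset_sums \<alpha> {1..int k})) \<le> U - L + 1"
    using \<open>L \<le> U\<close> by simp
  then have "2 * card (subset_sums \<alpha> {1..int k}) + \<alpha> * (\<alpha> + 1) \<le> k * (k + 1) + 2"
    using U L by linarith
  moreover have "k * (k + 1) + 2 \<le> 2 * card (subset_sums \<alpha> {1..int k}) + \<alpha> * (\<alpha> + 1)"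
    using card_subset_sums_ge[of "{1..int k}" \<alpha>] assms by simp
  ultimately show ?thesis by simp
qed

theorem theorem2p1:
  fixes k \<alpha> :: nat
  assumes "k \<ge> 1" and "\<alpha> \<le> k"
  shows "(\<forall>A :: int set. finite A \<and> card A = k \<and> (\<forall>a\<in>A. a > 0) \<longrightarrow>
            real (card (subset_sums \<alpha> A))
              \<ge> real k * (real k + 1) / 2 - real \<alpha> * (real \<alpha> + 1) / 2 + 1)
       \<and> (\<exists>A :: int set. finite A \<and> card A = k \<and> (\<forall>a\<in>A. a > 0) \<and>
            real (card (subset_sums \<alpha> A))
              = real k * (real k + 1) / 2 - real \<alpha> * (real \<alpha> + 1) / 2 + 1)"
proof (intro conjI allI impI)
  fix A :: "int set"
  assume A: "finite A \<and> card A = k \<and> (\<forall>a\<in>A. a > 0)"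
  then have "k * (k + 1) + 2 \<le> 2 * card (subset_sums \<alpha> A) + \<alpha> * (\<alpha> + 1)"
    using card_subset_sums_ge[of A \<alpha>] assms by simp
  then have "real (k * (k + 1) + 2) \<le> real (2 * card (subset_sums \<alpha> A) + \<alpha> * (\<alpha> + 1))"
    by (simp only: of_nat_le_iff)
  then show "real (card (subset_sums \<alpha> A))
      \<ge> real k * (real k + 1) / 2 - real \<alpha> * (real \<alpha> + 1) / 2 + 1"
    by (simp add: field_simps)
next
  have "real (2 * card (subset_sums \<alpha> {1..int k}) + \<alpha> * (\<alpha> + 1)) = real (k * (k + 1) + 2)"
    using card_subset_sums_atLeastAtMost[OF assms(2)] by (simp only:)
  then have "real (card (subset_sums \<alpha> {1..int k}))
      = real k * (real k + 1) / 2 - real \<alpha> * (real \<alpha> + 1) / 2 + 1"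
    by (simp add: field_simps)
  then show "\<exists>A :: int set. finite A \<and> card A = k \<and> (\<forall>a\<in>A. a > 0) \<and>
      real (card (subset_sums \<alpha> A))
        = real k * (real k + 1) / 2 - real \<alpha> * (real \<alpha> + 1) / 2 + 1"
    by (intro exI[of _ "{1..int k}"]) auto
qed

end
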